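(* Let $K\ge2$ and let $p_1,\dots,p_K,q_1,\dots,q_K\in[0,1]$ with $\sum_{k=1}^K p_k=\sum_{k=1}^K q_k=1$ be such that the ratios $r_k=p_k/q_k\in[0,\infty]$, $k\in\{1,\dots,K\}$, are well defined and $r_1\le r_2\le\dots\le r_K$. Let $\tilde C_{\mathrm{CL}}$ be the comonotonic-based Liebscher copula $$\tilde C_{\mathrm{CL}}(u,v)=\prod_{k=1}^K\min(u^{p_k},v^{q_k}),\qquad (u,v)\in[0,1]^2.$$ Then Blomqvist's medial correlation coefficient $\beta$, Kendall's $\tau$ and Spearman's $\rho$ of $\tilde C_{\mathrm{CL}}$ are respectively given by $$\beta(\tilde C_{\mathrm{CL}})=2^{\sum_{k=1}^K\min(p_k,q_k)}-1,$$ $$\tau(\tilde C_{\mathrm{CL}})=1-\sum_{k=1}^{K-1}\frac{(1-\bar p_k)\,\bar q_k\,(r_{k+1}-r_k)}{(\bar q_k r_k+(1-\bar p_k))(\bar q_k r_{k+1}+(1-\bar p_k))},$$ $$\rho(\tilde C_{\mathrm{CL}})=\frac{12(1+r_1+r_1r_K)}{(2+r_1)(1+2r_K)}-3+12\sum_{k=1}^{K-1}\frac{r_{k+1}-r_k}{((1+\bar q_k)r_k+(2-\bar p_k))((1+\bar q_k)r_{k+1}+(2-\bar p_k))},$$ where $\bar x_k=x_1+\dots+x_k$.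
   Context: For a bivariate copula $C$: $\beta(C)=4C(\tfrac12,\tfrac12)-1$, $\tau(C)=4\int_{[0,1]^2}C(u,v)\,dC(u,v)-1$, $\rho(C)=12\int_{[0,1]^2}C(u,v)\,du\,dv-3$. The ratio $r_k=p_k/q_k$ is well defined when $(p_k,q_k)\ne(0,0)$, with $r_k=\infty$ if $q_k=0<p_k$. If some $r_i=\infty$, the expressions are understood as limits: a summand with $r_k=r_{k+1}$ is $0$; a summand with $r_k<r_{k+1}=\infty$ is its limit as $r_{k+1}\to\infty$; and if $r_K=\infty$ the first term of $\rho$ is its limit as $r_K\to\infty$. *)

theory Defs
  imports "HOL-Probability.Probability"
begin

text \<open>
  Functions on the unit square are curried functions \<^typ>\<open>real \<Rightarrow> real \<Rightarrow> real\<close> of which only the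
  values on the unit square matter. The integrator \<open>dC\<close> is the Borel probability measure whose
  distribution function on the unit square is \<open>C\<close>. Such a measure is carried by the unit square
  and is unique (lemma \<open>copula_measure_eqI\<close>).
\<close>

definition copula_measure :: "(real \<Rightarrow> real \<Rightarrow> real) \<Rightarrow> (real \<times> real) measure" where
  "copula_measure C = (THE M. prob_space M \<and> sets M = sets borel \<and>
     (\<forall>u\<in>{0..1}. \<forall>v\<in>{0..1}. measure M ({0..u} \<times> {0..v}) = C u v))"

definition blomqvist_beta :: "(real \<Rightarrow> real \<Rightarrow> real) \<Rightarrow> real" where
  "blomqvist_beta C = 4 * C (1/2) (1/2) - 1"

definition kendall_tau :: "(real \<Rightarrow> real \<Rightarrow> real) \<Rightarrow> real" where
  "kendall_tau C = 4 * (LINT z:{0..1} \<times> {0..1}|copula_measure C. C (fst z) (snd z)) - 1"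

definition spearman_rho :: "(real \<Rightarrow> real \<Rightarrow> real) \<Rightarrow> real" where
  "spearman_rho C = 12 * (LINT z:{0..1} \<times> {0..1}|lborel. C (fst z) (snd z)) - 3"

text \<open>
  In the library \<open>0 powr 0 = 0\<close> rather than \<open>1\<close>. This does not affect the product below: as
  the \<open>p k\<close> sum to \<open>1\<close>, some \<open>p k\<close> is positive, so the product vanishes at \<open>u = 0\<close> under either
  convention; likewise at \<open>v = 0\<close>.
\<close>

definition comonotonic_liebscher ::
    "nat \<Rightarrow> (nat \<Rightarrow> real) \<Rightarrow> (nat \<Rightarrow> real) \<Rightarrow> real \<Rightarrow> real \<Rightarrow> real" where
  "comonotonic_liebscher K p q u v = (\<Prod>k=1..K. min (u powr p k) (v powr q k))"

text \<open>Division on \<^typ>\<open>ennreal\<close> gives \<open>x / 0 = \<infinity>\<close> for \<open>x > 0\<close>.\<close>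

definition ratio :: "(nat \<Rightarrow> real) \<Rightarrow> (nat \<Rightarrow> real) \<Rightarrow> nat \<Rightarrow> ennreal" where
  "ratio p q k = ennreal (p k) / ennreal (q k)"

definition at_ratio :: "(real \<Rightarrow> real) \<Rightarrow> ennreal \<Rightarrow> real" where
  "at_ratio f s = (if s = \<infinity> then Lim at_top f else f (enn2real s))"

text \<open>The case \<open>r = \<infinity> \<noteq> s\<close> does not arise for increasing ratios.\<close>

definition ratio_summand :: "(real \<Rightarrow> real \<Rightarrow> real) \<Rightarrow> ennreal \<Rightarrow> ennreal \<Rightarrow> real" where
  "ratio_summand F r s = (if r = s then 0 else at_ratio (F (enn2real r)) s)"

lemma copula_measure_eqI:
  assumes M: "prob_space M" "sets M = sets borel"
    and cdf: "\<And>u v. u \<in> {0..1} \<Longrightarrow> v \<in> {0..1} \<Longrightarrow> measure M ({0..u} \<times> {0..v}) = C u v"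
    and C1: "C 1 1 = 1"
  shows "copula_measure C = M"
proof -
  have box: "emeasure L {..(a, b)} =
      (if a < 0 \<or> b < 0 then 0 else ennreal (C (min a 1) (min b 1)))"
    if L: "prob_space L" "sets L = sets borel"
      and cdfL: "\<And>u v. u \<in> {0..1} \<Longrightarrow> v \<in> {0..1} \<Longrightarrow> measure L ({0..u} \<times> {0..v}) = C u v"
    for L and a b :: real
  proof -
    interpret L: prob_space L by fact
    have m: "A \<times> B \<in> sets L" if "closed A" "closed B" for A B :: "real set"
      using that by (simp add: L(2) closed_Times borel_closed)
    have "L.prob ({0..1} \<times> {0..1}) = 1"
      using cdfL[of 1 1] C1 by simp
    moreover have "{0..1} \<times> {0..1} \<in> sets L"
      by (intro m) auto
    ultimately have AE: "AE z in L. z \<in> {0..1} \<times> {0..1}"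
      using L.prob_eq_1 by blast
    define S where "S = (if a < 0 \<or> b < 0 then {} else {0..min a 1} \<times> {0..min b 1})"
    have "emeasure L {..(a, b)} = emeasure L S"
    proof (rule emeasure_eq_AE)
      show "AE z in L. (z \<in> {..(a, b)}) = (z \<in> S)"
        using AE by eventually_elim (auto simp: S_def less_eq_prod_def)
      show "{..(a, b)} \<in> sets L"
        by (simp add: L(2))
      show "S \<in> sets L"
        by (auto simp: S_def intro!: m)
    qed
    then show ?thesis
      using cdfL[of "min a 1" "min b 1"] by (auto simp: S_def L.emeasure_eq_measure)
  qed
  have "N = M" if N: "prob_space N" "sets N = sets borel"
    and cdfN: "\<And>u v. u \<in> {0..1} \<Longrightarrow> v \<in> {0..1} \<Longrightarrow> measure N ({0..u} \<times> {0..v}) = C u v" for N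
  proof (rule measure_eqI_generator_eq[where E = "range atMost" and \<Omega> = UNIV
        and A = "\<lambda>n. {..(real n, real n)}"])
    interpret N: prob_space N by fact
    show "Int_stable (range atMost :: (real \<times> real) set set)"
    proof (rule Int_stableI)
      fix A B :: "(real \<times> real) set"
      assume "A \<in> range atMost" "B \<in> range atMost"
      then obtain x y where "A = {..x}" "B = {..y}"
        by auto
      then have "A \<inter> B = {..inf x y}"
        by auto
      then show "A \<inter> B \<in> range atMost"
        by blast
    qed
    show "emeasure N X = emeasure M X" if "X \<in> range atMost" for X
    proof -
      from that obtain a b where "X = {..(a, b)}"
        by auto
      then show ?thesis
        using box[OF N cdfN] box[OF M cdf] by simp
    qed
    show "sets N = sigma_sets UNIV (range atMost)" "sets M = sigma_sets UNIV (range atMost)"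
      using N(2) M(2) by (simp_all add: borel_eq_atMost)
    show "(\<Union>n. {..(real n, real n)}) = UNIV"
    proof -
      have "\<exists>n. x \<le> real n \<and> y \<le> real n" for x y :: real
        using real_arch_simple[of "max x y"] by auto
      then show ?thesis
        by (auto simp: less_eq_prod_def)
    qed
    show "emeasure N {..(real n, real n)} \<noteq> \<infinity>" for n
      by (simp add: N.emeasure_eq_measure)
    show "range (\<lambda>n. {..(real n, real n)}) \<subseteq> range atMost"
      by blast
  qed simp_all
  then show ?thesis
    unfolding copula_measure_def
    by (intro the_equality conjI ballI M cdf; blast)
qed

end

theory Submission
  imports Defs "HOL-Real_Asymp.Real_Asymp"
begin

text \<open>
  Write \<open>C\<close> for the copula. For \<open>0 < u, v\<close> it is the exponential of the sum of the
  \<open>min (p k * ln u) (q k * ln v)\<close>, and which argument of the \<open>k\<close>-th minimum is smaller depends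
  only on the side of the curve \<open>v = u powr r k\<close> on which \<open>(u, v)\<close> lies. As the ratios
  increase, these curves cut the unit square into \<open>K + 1\<close> consecutive sectors
  \<open>u powr r (k + 1) < v < u powr r k\<close>, where \<open>r 0 = 0\<close> and \<open>r (K + 1) = \<infinity>\<close>, and in the
  \<open>k\<close>-th sector the copula is the monomial \<open>u powr (1 - P k) * v powr Q k\<close>
  (lemma \<open>C_sector\<close>). The value of \<open>\<beta>\<close> can be read off from the exponential form.

  The integral of \<open>c * u powr (\<alpha> - 1) * v powr (\<beta> - 1)\<close> over a sector is elementary: integrating
  first in \<open>v\<close> and then in \<open>u\<close> gives
  \<open>c / \<beta> * (1 / (\<alpha> + \<beta> * r k) - 1 / (\<alpha> + \<beta> * r (k + 1)))\<close>, where \<open>1 / \<infinity> = 0\<close>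
  (lemma \<open>nn_integral_sectors\<close>). With \<open>c = 1\<close>, \<open>\<alpha> = 2 - P k\<close> and \<open>\<beta> = 1 + Q k\<close> the sum over
  all sectors is the integral of \<open>C\<close>, hence Spearman's \<open>\<rho>\<close>.

  The copula measure has a singular part on the curves \<open>v = u powr r k\<close>, which makes a direct
  computation of \<open>\<tau>\<close> awkward. Integration by parts avoids it: for any copula with absolutely
  continuous sections, \<open>\<integral> C dC = 1/2 - \<integral> \<integral> \<partial>\<^sub>1 C * \<partial>\<^sub>2 C\<close>
  (lemma \<open>integration_by_parts_copula\<close>). In the \<open>k\<close>-th sector the product of the two partial
  derivatives is the monomial with \<open>c = (1 - P k) * Q k\<close>, \<open>\<alpha> = 2 * (1 - P k)\<close> and
  \<open>\<beta> = 2 * Q k\<close>, so the same sector integral yields \<open>\<tau>\<close>.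

  That \<open>C\<close> is the distribution function of a probability measure follows from a common shock
  model: if \<open>W k\<close> are independent and uniform on the unit interval, then \<open>C\<close> is the joint
  distribution function of the maxima of the \<open>W k powr (1 / p k)\<close> and of the
  \<open>W k powr (1 / q k)\<close> (lemma \<open>copula_measure\<close>).
\<close>

section \<open>Integration by parts for copulas\<close>

lemma nn_integral_powr:
  fixes l h b :: real
  assumes "0 < b" "0 \<le> l" "l \<le> h"
  shows "(\<integral>\<^sup>+v. ennreal (v powr (b - 1)) * indicator {l..h} v \<partial>lborel)
    = ennreal ((h powr b - l powr b) / b)"
proof (rule nn_integral_has_integral_lebesgue')
  have "((\<lambda>v. v powr (b - 1)) has_integral (h powr b / b - l powr b / b)) {l..h}"
  proof (rule fundamental_theorem_of_calculus_interior)
    show "l \<le> h" by fact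
    show "continuous_on {l..h} (\<lambda>v. v powr b / b)"
      using assms by (auto intro!: continuous_intros continuous_on_powr')
    show "((\<lambda>v. v powr b / b) has_vector_derivative v powr (b - 1)) (at v)"
      if "v \<in> {l<..<h}" for v
      using that assms unfolding has_real_derivative_iff_has_vector_derivative[symmetric]
      by (auto intro!: derivative_eq_intros)
  qed
  then show "((\<lambda>v. v powr (b - 1)) has_integral ((h powr b - l powr b) / b)) {l..h}"
    by (simp add: diff_divide_distrib)
qed simp

text \<open>
  The measure of \<open>{0..x} \<times> {0..t}\<close>, as a function of \<open>t\<close>, is the distribution function of the
  projection of the strip onto the second axis. A density of this function in \<open>t\<close> is
  therefore a density of the projected measure.
\<close>

lemma nn_integral_strip:
  fixes M :: "(real \<times> real) measure" and g \<phi> :: "real \<Rightarrow> ennreal"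
  assumes M: "prob_space M" "sets M = sets borel"
    and [measurable]: "g \<in> borel_measurable borel" "\<phi> \<in> borel_measurable borel"
    and cdf: "\<And>t. t \<in> {0..1} \<Longrightarrow>
      emeasure M ({0..x} \<times> {0..t}) = (\<integral>\<^sup>+y. g y * indicator {0..t} y \<partial>lborel)"
  shows "(\<integral>\<^sup>+z. \<phi> (snd z) * indicator ({0..x} \<times> {0..1}) z \<partial>M)
    = (\<integral>\<^sup>+y. \<phi> y * g y * indicator {0..1} y \<partial>lborel)"
proof -
  interpret M: prob_space M by fact
  note [measurable_cong] = M(2)
  have box [measurable]: "{0..x} \<times> {a..b} \<in> sets borel" for a b :: real
    by (intro borel_closed closed_Times) auto
  have snd_M [measurable]: "snd \<in> borel_measurable M"
    unfolding measurable_cong_sets[OF M(2) refl]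
    by (auto intro!: borel_measurable_continuous_onI continuous_intros)
  have UNIV_borel: "UNIV \<in> sets (borel :: real measure)" by simp
  define N1 where "N1 = distr (density M (indicator ({0..x} \<times> {0..1}))) borel snd"
  define N2 where "N2 = density lborel (\<lambda>y. g y * indicator {0..1} y)"
  have N1: "emeasure N1 A = (\<integral>\<^sup>+z. indicator ({0..x} \<times> {0..1}) z * indicator A (snd z) \<partial>M)"
    if [measurable]: "A \<in> sets borel" for A
  proof -
    have "emeasure N1 A = (\<integral>\<^sup>+y. indicator A y \<partial>N1)"
      by (simp add: N1_def)
    also have "\<dots> = (\<integral>\<^sup>+z. indicator ({0..x} \<times> {0..1}) z * indicator A (snd z) \<partial>M)"
      unfolding N1_def by (simp add: nn_integral_distr nn_integral_density del: nn_integral_indicator)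
    finally show ?thesis .
  qed
  have N2: "emeasure N2 A = (\<integral>\<^sup>+y. g y * indicator {0..1} y * indicator A y \<partial>lborel)"
    if [measurable]: "A \<in> sets borel" for A
    unfolding N2_def by (subst emeasure_density) auto
  have "N1 = N2"
  proof (rule cdf_unique')
    have "emeasure N1 {..t} = emeasure N2 {..t}" for t
    proof (cases "t < 0")
      case True
      have "emeasure N1 {..t} = (\<integral>\<^sup>+z. 0 \<partial>M)"
        using True unfolding N1[OF atMost_borel]
        by (intro nn_integral_cong) (auto simp: indicator_def)
      moreover have "emeasure N2 {..t} = (\<integral>\<^sup>+(y::real). 0 \<partial>lborel)"
        using True unfolding N2[OF atMost_borel]
        by (intro nn_integral_cong) (auto simp: indicator_def)
      ultimately show ?thesis by simp
    next
      case False
      have "emeasure N1 {..t} = (\<integral>\<^sup>+z. indicator ({0..x} \<times> {0..min t 1}) z \<partial>M)"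
        using False unfolding N1[OF atMost_borel]
        by (intro nn_integral_cong) (auto simp: indicator_def)
      also have "\<dots> = (\<integral>\<^sup>+y. g y * indicator {0..min t 1} y \<partial>lborel)"
        using cdf[of "min t 1"] False by (subst nn_integral_indicator) (auto simp: M(2))
      also have "\<dots> = emeasure N2 {..t}"
        using False unfolding N2[OF atMost_borel]
        by (intro nn_integral_cong) (auto simp: indicator_def)
      finally show ?thesis .
    qed
    then show "cdf N1 = cdf N2"
      by (auto simp: cdf_def measure_def)
    have "emeasure N1 UNIV \<le> (\<integral>\<^sup>+z. 1 \<partial>M)"
      unfolding N1[OF UNIV_borel]
      by (intro nn_integral_mono) (auto simp: indicator_def)
    also have "\<dots> < \<infinity>"
      using M.emeasure_space_1 by simp
    finally have "finite_measure N1"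
      by (intro finite_measureI) (auto simp: N1_def)
    then show "finite_borel_measure N1"
      by (simp add: finite_borel_measure_def finite_borel_measure_axioms_def N1_def)
    have "emeasure N2 UNIV = emeasure M ({0..x} \<times> {0..1})"
      using cdf[of 1] by (subst N2) auto
    also have "\<dots> < \<infinity>"
      by (simp add: M.emeasure_eq_measure)
    finally have "finite_measure N2"
      by (intro finite_measureI) (auto simp: N2_def)
    then show "finite_borel_measure N2"
      by (simp add: finite_borel_measure_def finite_borel_measure_axioms_def N2_def)
  qed
  have "(\<integral>\<^sup>+z. \<phi> (snd z) * indicator ({0..x} \<times> {0..1}) z \<partial>M) = (\<integral>\<^sup>+y. \<phi> y \<partial>N1)"
    unfolding N1_def by (simp add: nn_integral_distr nn_integral_density mult.commute)
  also have "\<dots> = (\<integral>\<^sup>+y. \<phi> y \<partial>N2)"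
    by (simp only: \<open>N1 = N2\<close>)
  also have "\<dots> = (\<integral>\<^sup>+y. \<phi> y * g y * indicator {0..1} y \<partial>lborel)"
    unfolding N2_def by (subst nn_integral_density) (auto intro!: nn_integral_cong simp: ac_simps)
  finally show ?thesis .
qed

text \<open>
  As \<open>C u v + (\<integral>x\<in>{u..1}. D1 x v) = v\<close>, integrating over the copula measure and exchanging the
  integrals leaves, for each \<open>x\<close>, the integral of \<open>D1 x v\<close> over the strip \<open>u \<le> x\<close>. There the
  second coordinate has density \<open>D2 x\<close>. The right-hand side is the mean \<open>1/2\<close> of the uniform
  second coordinate. The identity is stated as a sum, which keeps it free of subtraction in
  \<^typ>\<open>ennreal\<close>.
\<close>

lemma integration_by_parts_copula:
  fixes C D1 D2 :: "real \<Rightarrow> real \<Rightarrow> real"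
  assumes M: "prob_space M" "sets M = sets borel"
    and cdf: "\<And>u v. u \<in> {0..1} \<Longrightarrow> v \<in> {0..1} \<Longrightarrow> measure M ({0..u} \<times> {0..v}) = C u v"
    and margin: "\<And>v. v \<in> {0..1} \<Longrightarrow> C 1 v = v"
    and C_meas: "(\<lambda>z. C (fst z) (snd z)) \<in> borel_measurable borel"
    and D1_meas: "(\<lambda>z. D1 (fst z) (snd z)) \<in> borel_measurable borel"
    and D2_meas: "(\<lambda>z. D2 (fst z) (snd z)) \<in> borel_measurable borel"
    and D1: "\<And>u v. u \<in> {0..1} \<Longrightarrow> v \<in> {0..1} \<Longrightarrow>
      (\<integral>\<^sup>+x. ennreal (D1 x v) * indicator {u..1} x \<partial>lborel) = ennreal (C 1 v - C u v)"
    and D2: "\<And>u v. u \<in> {0..1} \<Longrightarrow> v \<in> {0..1} \<Longrightarrow>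
      (\<integral>\<^sup>+y. ennreal (D2 u y) * indicator {0..v} y \<partial>lborel) = ennreal (C u v)"
  shows "(\<integral>\<^sup>+z. ennreal (C (fst z) (snd z)) * indicator ({0..1} \<times> {0..1}) z \<partial>M)
    + (\<integral>\<^sup>+x. (\<integral>\<^sup>+y. ennreal (D1 x y) * ennreal (D2 x y) * indicator {0..1} y \<partial>lborel)
        * indicator {0..1} x \<partial>lborel) = ennreal (1/2)"
proof -
  interpret M: prob_space M by fact
  note [measurable_cong] = M(2)
  note [measurable] = C_meas
  define D1u where "D1u = (\<lambda>z. D1 (fst z) (snd z))"
  define D2u where "D2u = (\<lambda>z. D2 (fst z) (snd z))"
  have uncurry: "D1 x y = D1u (x, y)" "D2 x y = D2u (x, y)" for x y
    by (simp_all add: D1u_def D2u_def)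
  have [measurable]: "D1u \<in> borel_measurable borel" "D2u \<in> borel_measurable borel"
    using D1_meas D2_meas by (simp_all add: D1u_def D2u_def)
  have box [measurable]: "{0..x} \<times> {a..b} \<in> sets borel" for a b x :: real
    by (intro borel_closed closed_Times) auto
  interpret pair_sigma_finite M lborel ..
  let ?S = "{0..1} \<times> {0..1} :: (real \<times> real) set"
  \<comment> \<open>The pair \<open>w\<close> consists of a point \<open>(u, v)\<close> of the square and of the variable \<open>x \<ge> u\<close>.\<close>
  let ?D = "\<lambda>w. ennreal (D1u (snd w, snd (fst w))) * indicator ({0..snd w} \<times> {0..1}) (fst w)
        * indicator {0..1} (snd w) :: ennreal"
  have split: "ennreal (C (fst z) (snd z)) * indicator ?S z + (\<integral>\<^sup>+x. ?D (z, x) \<partial>lborel)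
      = ennreal (snd z) * indicator ({0..1} \<times> {0..1}) z" for z
  proof (cases "z \<in> ?S")
    case True
    then obtain u v where z: "z = (u, v)" "u \<in> {0..1}" "v \<in> {0..1}" by auto
    have "C u v \<le> C 1 v"
      using z by (subst (1 2) cdf[symmetric]) (auto intro!: M.finite_measure_mono simp: M(2))
    moreover have "0 \<le> C u v"
      using z by (subst cdf[symmetric]) auto
    moreover have "(\<integral>\<^sup>+x. ?D (z, x) \<partial>lborel) = (\<integral>\<^sup>+x. ennreal (D1u (x, v)) * indicator {u..1} x \<partial>lborel)"
      using z by (intro nn_integral_cong) (auto simp: indicator_def)
    ultimately show ?thesis
      using True z margin[of v] D1[of u v] by (simp add: uncurry flip: ennreal_plus)
  next
    case False
    then have "(\<integral>\<^sup>+x. ?D (z, x) \<partial>lborel) = (\<integral>\<^sup>+(x::real). 0 \<partial>lborel)"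
      by (intro nn_integral_cong) (auto simp: indicator_def)
    with False show ?thesis by simp
  qed
  have fst_M: "fst \<in> borel_measurable M" and snd_M: "snd \<in> borel_measurable M"
    unfolding measurable_cong_sets[OF M(2) refl]
    by (auto intro!: borel_measurable_continuous_onI continuous_intros)
  have [measurable]: "(\<lambda>w. fst (fst w)) \<in> borel_measurable (M \<Otimes>\<^sub>M lborel)"
      "(\<lambda>w. snd (fst w)) \<in> borel_measurable (M \<Otimes>\<^sub>M lborel)"
    using measurable_compose[OF measurable_fst fst_M] measurable_compose[OF measurable_fst snd_M]
    by auto
  have meas_ind [measurable]:
    "(\<lambda>w. indicator ({0..snd w} \<times> {0..1}) (fst w) :: ennreal) \<in> borel_measurable (M \<Otimes>\<^sub>M lborel)"
  proof -
    have "(\<lambda>w. indicator ({0..snd w} \<times> {0..1}) (fst w) :: ennreal) = (\<lambda>w. if 0 \<le> fst (fst w) \<and> fst (fst w) \<le> snd w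
       \<and> 0 \<le> snd (fst w) \<and> snd (fst w) \<le> (1::real) then 1 else 0)"
      by (auto simp: fun_eq_iff indicator_def mem_Times_iff)
    also have "\<dots> \<in> borel_measurable (M \<Otimes>\<^sub>M lborel)" by measurable
    finally show ?thesis .
  qed
  \<comment> \<open>For fixed \<open>x\<close> the inner integral runs over the strip \<open>u \<le> x\<close>.\<close>
  have inner: "(\<integral>\<^sup>+z. ?D (z, x) \<partial>M)
      = (\<integral>\<^sup>+y. ennreal (D1u (x, y)) * ennreal (D2u (x, y)) * indicator {0..1} y \<partial>lborel) * indicator {0..1} x" for x
  proof (cases "x \<in> {0..1}")
    case True
    have "(\<integral>\<^sup>+z. ?D (z, x) \<partial>M) = (\<integral>\<^sup>+z. ennreal (D1u (x, snd z)) * indicator ({0..x} \<times> {0..1}) z \<partial>M)"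
      using True by simp
    also have "\<dots> = (\<integral>\<^sup>+y. ennreal (D1u (x, y)) * ennreal (D2u (x, y)) * indicator {0..1} y \<partial>lborel)"
      using M True by (intro nn_integral_strip) (auto simp: D2[unfolded uncurry] cdf M.emeasure_eq_measure)
    finally show ?thesis using True by simp
  qed auto
  have "(\<integral>\<^sup>+z. ennreal (C (fst z) (snd z)) * indicator ?S z \<partial>M)
      + (\<integral>\<^sup>+x. (\<integral>\<^sup>+z. ?D (z, x) \<partial>M) \<partial>lborel)
      = (\<integral>\<^sup>+z. ennreal (C (fst z) (snd z)) * indicator ?S z \<partial>M)
      + (\<integral>\<^sup>+z. (\<integral>\<^sup>+x. ?D (z, x) \<partial>lborel) \<partial>M)"
    by (subst Fubini') simp_all
  also have "\<dots> = (\<integral>\<^sup>+z. ennreal (C (fst z) (snd z)) * indicator ?S z + (\<integral>\<^sup>+x. ?D (z, x) \<partial>lborel) \<partial>M)"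
    by (subst nn_integral_add) simp_all
  also have "\<dots> = (\<integral>\<^sup>+z. ennreal (snd z) * indicator ({0..1} \<times> {0..1}) z \<partial>M)"
    by (simp only: split)
  also have "\<dots> = (\<integral>\<^sup>+y. ennreal y * 1 * indicator {0..1} y \<partial>lborel)"
    using M by (intro nn_integral_strip) (auto simp: cdf margin M.emeasure_eq_measure)
  also have "\<dots> = (\<integral>\<^sup>+y. ennreal (y powr (2 - 1)) * indicator {0..1} y \<partial>lborel)"
    by (intro nn_integral_cong) (auto simp: indicator_def)
  also have "\<dots> = ennreal (1/2)"
    by (subst nn_integral_powr) auto
  finally show ?thesis
    by (simp only: inner uncurry)
qed

section \<open>The comonotonic-based Liebscher copula as a distribution function\<close>

text \<open>
  The implication makes the case \<open>a = 0\<close> agree with \<open>u powr 0 = 1\<close>: a shock with exponent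
  \<open>0\<close> imposes no constraint.
\<close>

lemma powr_inverse_le_iff:
  fixes a u w :: real
  assumes "0 \<le> a" "0 < u" "0 \<le> w" "w \<le> 1"
  shows "(0 < a \<longrightarrow> w powr (1 / a) \<le> u) \<longleftrightarrow> w \<le> u powr a"
proof (cases "a = 0")
  case True
  with assms show ?thesis by simp
next
  case False
  then have a: "0 < a" "0 \<le> 1 / a"
    using assms(1) by simp_all
  have "w powr (1 / a) \<le> u \<longleftrightarrow> w \<le> u powr a"
  proof
    assume "w powr (1 / a) \<le> u"
    then have "(w powr (1 / a)) powr a \<le> u powr a"
      by (intro powr_mono2) (use a in simp_all)
    then show "w \<le> u powr a"
      using a assms(3) by (simp add: powr_powr)
  next
    assume "w \<le> u powr a"
    then have "w powr (1 / a) \<le> (u powr a) powr (1 / a)"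
      using a assms(3) by (intro powr_mono2)
    then show "w powr (1 / a) \<le> u"
      using a assms(2) by (simp add: powr_powr)
  qed
  with a show ?thesis by blast
qed

locale liebscher_weights =
  fixes K :: nat and p q :: "nat \<Rightarrow> real"
  assumes p_nonneg: "k \<in> {1..K} \<Longrightarrow> 0 \<le> p k" and q_nonneg: "k \<in> {1..K} \<Longrightarrow> 0 \<le> q k"
    and sum_p: "(\<Sum>k=1..K. p k) = 1" and sum_q: "(\<Sum>k=1..K. q k) = 1"
begin

abbreviation C :: "real \<Rightarrow> real \<Rightarrow> real" where
  "C \<equiv> comonotonic_liebscher K p q"

text \<open>
  All hypotheses are symmetric, so every fact about the first coordinate yields one about the
  second coordinate.
\<close>

lemma swap: "liebscher_weights K q p"
  by unfold_locales (simp_all only: p_nonneg q_nonneg sum_p sum_q)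

lemma C_swap: "comonotonic_liebscher K q p v u = C u v"
  by (simp add: comonotonic_liebscher_def min.commute)

lemma p_pos_ex: obtains j where "j \<in> {1..K}" "0 < p j"
proof -
  have "\<exists>j\<in>{1..K}. p j \<noteq> 0"
    using sum_p by (metis sum.neutral zero_neq_one)
  then show thesis using p_nonneg that by (metis less_eq_real_def)
qed

lemma C_0_left: "C 0 v = 0"
proof -
  obtain j where "j \<in> {1..K}" using p_pos_ex by blast
  moreover have "min (0 powr p j) (v powr q j) = 0" by (simp add: min_def)
  ultimately show ?thesis
    unfolding comonotonic_liebscher_def by (intro prod_zero finite_atLeastAtMost) blast
qed

lemma C_0_right: "C u 0 = 0"
  using liebscher_weights.C_0_left[OF swap] unfolding C_swap .

lemma C_1_left: "C 1 v = v" if "v \<in> {0..1}"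
proof (cases "v = 0")
  case False
  have "C 1 v = (\<Prod>k=1..K. v powr q k)"
    unfolding comonotonic_liebscher_def
    using that q_nonneg by (intro prod.cong) (simp_all add: min_absorb2 powr_le1)
  also have "\<dots> = v"
    using that False powr_sum[of v q "{1..K}"] sum_q by simp
  finally show ?thesis .
qed (simp add: C_0_right)

text \<open>
  The event that both maxima \<open>max (W k powr (1 / p k))\<close> and \<open>max (W k powr (1 / q k))\<close> stay below
  \<open>u\<close> and \<open>v\<close> is a product of constraints on the independent uniform \<open>W k\<close>; the \<open>k\<close>-th
  one is \<open>W k \<le> min (u powr p k) (v powr q k)\<close>.
\<close>

lemma copula_measure:
  "prob_space (copula_measure C)" (is ?prob)
  "sets (copula_measure C) = sets borel" (is ?sets)
  "u \<in> {0..1} \<Longrightarrow> v \<in> {0..1} \<Longrightarrow> measure (copula_measure C) ({0..u} \<times> {0..v}) = C u v"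
proof -
  define W :: "real measure" where "W = uniform_measure lborel {0..1}"
  have W: "prob_space W" unfolding W_def by (intro prob_space_uniform_measure) auto
  interpret W: product_prob_space "\<lambda>_. W" "{1..K}"
    by (simp add: product_prob_space_def product_sigma_finite_def product_prob_space_axioms_def W prob_space_imp_sigma_finite)
  have [measurable_cong]: "sets W = sets borel" by (simp add: W_def)
  have space_W: "space W = UNIV" by (simp add: W_def)
  define \<Omega> where "\<Omega> = Pi\<^sub>M {1..K} (\<lambda>_. W)"
  interpret \<Omega>: prob_space \<Omega> unfolding \<Omega>_def by (intro prob_space_PiM W)
  define X where "X a w = Max ((\<lambda>k. w k powr (1 / a k)) ` {k\<in>{1..K}. 0 < a k})" for a w :: "nat \<Rightarrow> real"
  have X_meas[measurable]: "X a \<in> borel_measurable \<Omega>" for a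
    unfolding X_def \<Omega>_def by measurable
  have X_bounds: "0 \<le> X a w \<and> (X a w \<le> u \<longleftrightarrow> (\<forall>k\<in>{1..K}. 0 < a k \<longrightarrow> w k powr (1 / a k) \<le> u))"
    if "j \<in> {1..K}" "0 < a j" for a w j u
  proof -
    have ne: "(\<lambda>k. w k powr (1 / a k)) ` {k\<in>{1..K}. 0 < a k} \<noteq> {}" using that by blast
    have "0 \<le> w j powr (1 / a j)" by simp
    also have "\<dots> \<le> X a w" unfolding X_def using that by (intro Max_ge) auto
    finally show ?thesis unfolding X_def using ne by (subst Max_le_iff) auto
  qed
  obtain i where i: "i \<in> {1..K}" "0 < p i" using p_pos_ex by blast
  obtain j where j: "j \<in> {1..K}" "0 < q j" using liebscher_weights.p_pos_ex[OF swap] by blast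
  define M where "M = distr \<Omega> borel (\<lambda>w. (X p w, X q w))"
  have prob: "prob_space M"
    unfolding M_def by (intro \<Omega>.prob_space_distr) measurable
  have sets: "sets M = sets borel" by (simp add: M_def)
  have cdf: "measure M ({0..u} \<times> {0..v}) = C u v" if u: "u \<in> {0..1}" and v: "v \<in> {0..1}" for u v
  proof -
    define A where "A k = {x::real. (0 < p k \<longrightarrow> x powr (1 / p k) \<le> u) \<and> (0 < q k \<longrightarrow> x powr (1 / q k) \<le> v)}" for k
    have A_meas[measurable]: "A k \<in> sets borel" for k unfolding A_def by measurable
    have "emeasure M ({0..u} \<times> {0..v}) = emeasure \<Omega> ((\<lambda>w. (X p w, X q w)) -` ({0..u} \<times> {0..v}) \<inter> space \<Omega>)"
      unfolding M_def by (intro emeasure_distr) (auto intro!: borel_closed closed_Times)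
    also have "(\<lambda>w. (X p w, X q w)) -` ({0..u} \<times> {0..v}) \<inter> space \<Omega> = Pi\<^sub>E {1..K} A"
    proof (rule set_eqI)
      fix w
      have "w \<in> (\<lambda>w. (X p w, X q w)) -` ({0..u} \<times> {0..v}) \<inter> space \<Omega>
          \<longleftrightarrow> X p w \<le> u \<and> X q w \<le> v \<and> w \<in> extensional {1..K}"
        using X_bounds[of i p, OF i, of w] X_bounds[of j q, OF j, of w]
        by (auto simp: \<Omega>_def space_PiM PiE_def space_W)
      also have "\<dots> \<longleftrightarrow> w \<in> Pi\<^sub>E {1..K} A"
        using X_bounds[of i p, OF i, of w u] X_bounds[of j q, OF j, of w v]
        unfolding PiE_iff A_def mem_Collect_eq by blast
      finally show "w \<in> (\<lambda>w. (X p w, X q w)) -` ({0..u} \<times> {0..v}) \<inter> space \<Omega> \<longleftrightarrow> w \<in> Pi\<^sub>E {1..K} A" .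
    qed
    also have "emeasure \<Omega> \<dots> = (\<Prod>k\<in>{1..K}. emeasure W (A k))"
      unfolding \<Omega>_def by (intro W.emeasure_PiM) auto
    finally have M: "emeasure M ({0..u} \<times> {0..v}) = (\<Prod>k\<in>{1..K}. emeasure W (A k))" .
    have WA: "emeasure W (A k) = emeasure lborel ({0..1} \<inter> A k)" for k
      unfolding W_def by (subst emeasure_uniform_measure) (auto simp: divide_ennreal_def)
    have zero: "emeasure W (A k) = 0" if "A k \<inter> {0..1} \<subseteq> {0}" for k
    proof -
      have "emeasure lborel ({0..1} \<inter> A k) \<le> emeasure lborel {0::real}"
        using that by (intro emeasure_mono) auto
      then show ?thesis by (simp add: WA)
    qed
    \<comment> \<open>At \<open>u = 0\<close> the convention \<open>0 powr 0 = 0\<close> breaks the identification of the single factors,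
      but both products vanish because of a factor with positive exponent.\<close>
    consider "u = 0" | "v = 0" | "0 < u" "0 < v" using u v by fastforce
    then show ?thesis
    proof cases
      case 1
      then have "emeasure W (A i) = 0" by (intro zero) (use i in \<open>auto simp: A_def\<close>)
      then have "emeasure M ({0..u} \<times> {0..v}) = 0" unfolding M using i by (intro prod_zero) auto
      then show ?thesis using 1 by (simp add: C_0_left measure_def)
    next
      case 2
      then have "emeasure W (A j) = 0" by (intro zero) (use j in \<open>auto simp: A_def\<close>)
      then have "emeasure M ({0..u} \<times> {0..v}) = 0" unfolding M using j by (intro prod_zero) auto
      then show ?thesis using 2 by (simp add: C_0_right measure_def)
    next
      case 3
      have "emeasure W (A k) = ennreal (min (u powr p k) (v powr q k))" if k: "k \<in> {1..K}" for k
      proof -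
        have le1: "u powr p k \<le> 1" "v powr q k \<le> 1"
          using u v 3 k p_nonneg q_nonneg by (auto intro!: powr_le1)
        have "x \<in> A k \<longleftrightarrow> x \<le> u powr p k \<and> x \<le> v powr q k" if "0 \<le> x" "x \<le> 1" for x
          using powr_inverse_le_iff[of "p k" u x] powr_inverse_le_iff[of "q k" v x]
            p_nonneg[OF k] q_nonneg[OF k] 3 that
          unfolding A_def mem_Collect_eq by (simp only:)
        then have "x \<in> {0..1} \<inter> A k \<longleftrightarrow> x \<in> {0..min (u powr p k) (v powr q k)}" for x
          using le1 by (cases "0 \<le> x \<and> x \<le> 1") (simp_all, linarith)
        then have eq: "{0..1} \<inter> A k = {0..min (u powr p k) (v powr q k)}"
          by (rule set_eqI)
        have "0 \<le> min (u powr p k) (v powr q k)" by simp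
        then show ?thesis unfolding WA eq by (subst emeasure_lborel_Icc) simp_all
      qed
      then have "emeasure M ({0..u} \<times> {0..v}) = (\<Prod>k\<in>{1..K}. ennreal (min (u powr p k) (v powr q k)))"
        unfolding M by simp
      also have "\<dots> = ennreal (C u v)"
        unfolding comonotonic_liebscher_def by (intro prod_ennreal) auto
      finally have "emeasure M ({0..u} \<times> {0..v}) = ennreal (C u v)" .
      moreover have "0 \<le> C u v"
        unfolding comonotonic_liebscher_def by (intro prod_nonneg) auto
      ultimately show ?thesis
        unfolding measure_def by (simp only: enn2real_ennreal)
    qed
  qed
  have "C 1 1 = 1"
    by (simp add: C_1_left)
  then have "copula_measure C = M"
    by (intro copula_measure_eqI prob sets cdf)
  then show ?prob ?sets
    "u \<in> {0..1} \<Longrightarrow> v \<in> {0..1} \<Longrightarrow> measure (copula_measure C) ({0..u} \<times> {0..v}) = C u v"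
    by (simp_all only: prob sets cdf)
qed

end

section \<open>Partial derivatives of the copula\<close>

context liebscher_weights
begin

lemma C_nonneg: "0 \<le> C u v"
  unfolding comonotonic_liebscher_def by (intro prod_nonneg) simp

lemma C_eq_exp:
  assumes "0 < u" "0 < v"
  shows "C u v = exp (\<Sum>k=1..K. min (p k * ln u) (q k * ln v))"
proof -
  have "min (u powr a) (v powr b) = exp (min (a * ln u) (b * ln v))" for a b
    using assms by (simp add: powr_def min_def)
  then show ?thesis
    by (simp add: comonotonic_liebscher_def exp_sum)
qed

text \<open>
  The derivative of the exponential form of \<open>C\<close> in \<open>u\<close>, valid wherever no minimum has a kink.
  On the kinks the value is immaterial, as they form a null set for each \<open>v\<close>.
\<close>

definition D1 :: "real \<Rightarrow> real \<Rightarrow> real" where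
  "D1 u v = C u v / u * (\<Sum>k=1..K. if p k * ln u < q k * ln v then p k else 0)"

lemma D1_nonneg: "0 \<le> u \<Longrightarrow> 0 \<le> D1 u v"
  unfolding D1_def by (intro mult_nonneg_nonneg divide_nonneg_nonneg sum_nonneg C_nonneg) (auto simp: p_nonneg)

lemma C_measurable:
  assumes [measurable]: "f \<in> borel_measurable M" "g \<in> borel_measurable M"
  shows "(\<lambda>x. C (f x) (g x)) \<in> borel_measurable M"
  unfolding comonotonic_liebscher_def by measurable

lemma D1_measurable:
  assumes [measurable]: "f \<in> borel_measurable M" "g \<in> borel_measurable M"
  shows "(\<lambda>x. D1 (f x) (g x)) \<in> borel_measurable M"
proof -
  note [measurable] = C_measurable
  show ?thesis unfolding D1_def by measurable
qed

text \<open>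
  For \<open>0 < a\<close> the only kink is at \<open>x = exp (b / a)\<close>; elsewhere the minimum is locally
  equal to one of its two arguments.
\<close>

lemma has_real_derivative_min_ln:
  fixes a b u :: real
  assumes "0 < u" "0 < a \<Longrightarrow> a * ln u \<noteq> b" "0 \<le> a"
  shows "((\<lambda>x. min (a * ln x) b) has_real_derivative (if a * ln u < b then a / u else 0)) (at u)"
proof (cases "a = 0")
  case False
  define m where "m = exp (b / a)"
  have a: "0 < a" using False assms by simp
  have less: "a * ln x < b \<longleftrightarrow> x < m" and greater: "b < a * ln x \<longleftrightarrow> m < x" if "0 < x" for x
    using that a ln_less_cancel_iff[of x m] ln_less_cancel_iff[of m x]
    by (simp_all add: m_def field_simps)
  show ?thesis
  proof (cases "u < m")
    case True
    have "((\<lambda>x. a * ln x) has_real_derivative a / u) (at u)"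
      using assms by (auto intro!: derivative_eq_intros)
    then have "((\<lambda>x. min (a * ln x) b) has_real_derivative a / u) (at u)"
      by (rule has_field_derivative_transform_within_open[where S = "{0<..<m}"])
        (use True assms less in \<open>force simp: min_def\<close>)+
    with True less assms show ?thesis by simp
  next
    case False
    with assms a greater less have u: "m < u" by (metis linorder_neqE)
    have "((\<lambda>x. b) has_real_derivative 0) (at u)"
      by simp
    then have "((\<lambda>x. min (a * ln x) b) has_real_derivative 0) (at u)"
    proof (rule has_field_derivative_transform_within_open[where S = "{m<..}"])
      show "b = min (a * ln x) b" if "x \<in> {m<..}" for x
        using that greater[of x] exp_gt_zero[of "b / a"] unfolding m_def by force
    qed (use u in auto)
    with u less assms show ?thesis by simp
  qed
qed simp

lemma C_has_derivative:
  assumes "0 < u" "0 < v" "\<And>k. k \<in> {1..K} \<Longrightarrow> 0 < p k \<Longrightarrow> p k * ln u \<noteq> q k * ln v"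
  shows "((\<lambda>x. C x v) has_real_derivative D1 u v) (at u)"
proof (rule has_field_derivative_transform_within_open[where S = "{0<..}"])
  have "((\<lambda>x. \<Sum>k=1..K. min (p k * ln x) (q k * ln v)) has_real_derivative
      (\<Sum>k=1..K. if p k * ln u < q k * ln v then p k / u else 0)) (at u)"
    by (intro DERIV_sum has_real_derivative_min_ln assms p_nonneg)
  also have "(\<Sum>k=1..K. if p k * ln u < q k * ln v then p k / u else 0)
      = (\<Sum>k=1..K. if p k * ln u < q k * ln v then p k else 0) / u"
    unfolding sum_divide_distrib by (intro sum.cong) auto
  finally show "((\<lambda>x. exp (\<Sum>k=1..K. min (p k * ln x) (q k * ln v))) has_real_derivative D1 u v) (at u)"
    unfolding D1_def C_eq_exp[OF assms(1,2)]
    by (rule DERIV_cong[OF DERIV_fun_exp]) simp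
qed (use assms C_eq_exp in auto)

text \<open>
  Only \<open>u = 0\<close> is delicate, since \<open>u powr 0\<close> jumps there. Replacing it by \<open>1\<close> changes no value
  of the product: at \<open>u = 0\<close> another factor vanishes.
\<close>

lemma continuous_on_C: "continuous_on {0..} (\<lambda>u. C u v)"
proof -
  define g where
    "g u = (\<Prod>k=1..K. if p k = 0 then min 1 (v powr q k) else min (u powr p k) (v powr q k))" for u
  obtain j where j: "j \<in> {1..K}" "0 < p j" using p_pos_ex by blast
  have "g 0 = 0"
    unfolding g_def by (intro prod_zero finite_atLeastAtMost bexI[of _ j]) (use j in auto)
  have C_eq_g: "C u v = g u" if "u \<in> {0..}" for u
  proof (cases "u = 0")
    case True
    with \<open>g 0 = 0\<close> C_0_left show ?thesis by simp
  next
    case False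
    then show ?thesis
      unfolding g_def comonotonic_liebscher_def by (intro prod.cong) auto
  qed
  have "continuous_on {0..} g"
    unfolding g_def
  proof (intro continuous_on_prod)
    fix k assume k: "k \<in> {1..K}"
    have "continuous_on {0..} (\<lambda>u. min (u powr p k) (v powr q k))" if "p k \<noteq> 0"
      using that p_nonneg[OF k]
      by (intro continuous_on_min continuous_on_powr' continuous_intros) auto
    then show "continuous_on {0..} (\<lambda>u. if p k = 0 then min 1 (v powr q k) else min (u powr p k) (v powr q k))"
      by (cases "p k = 0") auto
  qed
  then show ?thesis
    by (rule continuous_on_eq) (simp add: C_eq_g)
qed

text \<open>
  The fundamental theorem of calculus applies because \<open>C\<close> is continuous in \<open>u\<close> and
  differentiable off the finitely many kinks.
\<close>

lemma nn_integral_D1: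
  assumes "0 \<le> a" "a \<le> b" "0 \<le> v"
  shows "(\<integral>\<^sup>+x. ennreal (D1 x v) * indicator {a..b} x \<partial>lborel) = ennreal (C b v - C a v)"
proof (rule nn_integral_has_integral_lebesgue')
  show "((\<lambda>x. D1 x v) has_integral C b v - C a v) {a..b}"
  proof (cases "v = 0")
    case True
    then show ?thesis by (simp add: D1_def C_0_right)
  next
    case False
    with assms have v: "0 < v" by simp
    show ?thesis
    proof (rule fundamental_theorem_of_calculus_interior_strong)
      show "finite ((\<lambda>k. exp (q k * ln v / p k)) ` {1..K})" by simp
      show "continuous_on {a..b} (\<lambda>x. C x v)"
        by (rule continuous_on_subset[OF continuous_on_C]) (use assms in auto)
      fix x assume x: "x \<in> {a<..<b} - (\<lambda>k. exp (q k * ln v / p k)) ` {1..K}"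
      have "p k * ln x \<noteq> q k * ln v" if "k \<in> {1..K}" "0 < p k" for k
      proof
        assume "p k * ln x = q k * ln v"
        then have "q k * ln v / p k = ln x" using that by (simp add: field_simps)
        then have "x = exp (q k * ln v / p k)" using x assms by simp
        with x that show False by blast
      qed
      with x assms v show "((\<lambda>x. C x v) has_vector_derivative D1 x v) (at x)"
        unfolding has_real_derivative_iff_has_vector_derivative[symmetric]
        by (intro C_has_derivative) auto
    qed fact
  qed
qed (use assms D1_nonneg in auto)

end

section \<open>Integrals over sectors of the unit square\<close>

text \<open>
  The boundary curve of a sector. For \<open>0 < u < 1\<close> the value \<open>0\<close> at \<open>\<infinity>\<close> is the limit of
  \<open>u powr r\<close> as \<open>r\<close> grows.
\<close>

definition powr_ennreal :: "real \<Rightarrow> ennreal \<Rightarrow> real" where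
  "powr_ennreal u r = (if r = \<infinity> then 0 else u powr enn2real r)"

lemma powr_ennreal_nonneg: "0 \<le> powr_ennreal u r"
  by (simp add: powr_ennreal_def)

lemma powr_ennreal_antimono:
  assumes "0 < u" "u < 1" "r \<le> s"
  shows "powr_ennreal u s \<le> powr_ennreal u r"
proof (cases "s = \<infinity>")
  case False
  with assms have "enn2real r \<le> enn2real s" "r \<noteq> \<infinity>"
    by (auto simp: less_top intro!: enn2real_mono)
  with assms False show ?thesis
    by (simp add: powr_ennreal_def powr_mono')
qed (simp add: powr_ennreal_def)

text \<open>
  The curve \<open>v = u powr (a / b)\<close> is where \<open>a * ln u\<close> and \<open>b * ln v\<close> agree. For \<open>b = 0\<close> the
  curve degenerates to \<open>v = 0\<close>, and every point of the open unit square lies above it.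
\<close>

lemma ln_less_if_powr_ennreal_ratio:
  fixes a b u v :: real
  assumes "0 \<le> a" "0 \<le> b" "(a, b) \<noteq> (0, 0)" "0 < u" "u < 1" "0 < v"
  shows "v < powr_ennreal u (ennreal a / ennreal b) \<Longrightarrow> b * ln v < a * ln u"
    and "powr_ennreal u (ennreal a / ennreal b) < v \<Longrightarrow> a * ln u < b * ln v"
proof -
  have "(v < powr_ennreal u (ennreal a / ennreal b) \<longrightarrow> b * ln v < a * ln u) \<and>
    (powr_ennreal u (ennreal a / ennreal b) < v \<longrightarrow> a * ln u < b * ln v)"
  proof (cases "b = 0")
    case True
    with assms have "0 < a" "ennreal a / ennreal b = \<infinity>"
      by (simp_all add: ennreal_divide_eq_top_iff)
    moreover have "a * ln u < 0"
      using assms \<open>0 < a\<close> by (simp add: mult_pos_neg)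
    ultimately show ?thesis
      using True assms by (simp add: powr_ennreal_def)
  next
    case False
    with assms have b: "0 < b" by simp
    then have "powr_ennreal u (ennreal a / ennreal b) = exp (a / b * ln u)"
      using assms by (simp add: divide_ennreal powr_ennreal_def powr_def)
    moreover have "v < exp (a / b * ln u) \<longleftrightarrow> ln v < a / b * ln u"
      "exp (a / b * ln u) < v \<longleftrightarrow> a / b * ln u < ln v"
      using assms(6) by (metis exp_less_cancel_iff exp_ln)+
    ultimately show ?thesis
      using b by (simp add: field_simps)
  qed
  then show "v < powr_ennreal u (ennreal a / ennreal b) \<Longrightarrow> b * ln v < a * ln u"
    and "powr_ennreal u (ennreal a / ennreal b) < v \<Longrightarrow> a * ln u < b * ln v"
    by blast+
qed

lemma nn_integral_telescope:
  fixes e :: "nat \<Rightarrow> real" and f :: "real \<Rightarrow> ennreal"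
  assumes "\<And>k. k < n \<Longrightarrow> e (Suc k) \<le> e k" and [measurable]: "f \<in> borel_measurable borel"
  shows "(\<integral>\<^sup>+v. f v * indicator {e n..e 0} v \<partial>lborel)
    = (\<Sum>k<n. \<integral>\<^sup>+v. f v * indicator {e (Suc k)..e k} v \<partial>lborel)"
  using assms(1)
proof (induction n)
  case 0
  have "(\<integral>\<^sup>+v. f v * indicator {e 0..e 0} v \<partial>lborel) = (\<integral>\<^sup>+(v::real). 0 \<partial>lborel)"
    using AE_lborel_singleton[of "e 0"] by (intro nn_integral_cong_AE) (auto elim!: eventually_mono)
  then show ?case by simp
next
  case (Suc n)
  have "e n \<le> e 0"
    using Suc.prems by (intro lift_Suc_antimono_le[of "\<lambda>k. e (min k n)" 0 n, simplified]) (auto simp: min_def not_le Suc_le_eq)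
  moreover have "e (Suc n) \<le> e n"
    using Suc.prems by simp
  ultimately have "(\<integral>\<^sup>+v. f v * indicator {e (Suc n)..e 0} v \<partial>lborel)
      = (\<integral>\<^sup>+v. f v * indicator {e n..e 0} v + f v * indicator {e (Suc n)..e n} v \<partial>lborel)"
    using AE_lborel_singleton[of "e n"]
    by (intro nn_integral_cong_AE) (auto elim!: eventually_mono simp: indicator_def)
  also have "\<dots> = (\<integral>\<^sup>+v. f v * indicator {e n..e 0} v \<partial>lborel)
      + (\<integral>\<^sup>+v. f v * indicator {e (Suc n)..e n} v \<partial>lborel)"
    by (intro nn_integral_add) measurable
  finally show ?case
    using Suc by simp
qed

text \<open>
  The integral of \<open>u powr (\<alpha> - 1) * v powr \<beta>\<close> in \<open>u\<close> along the curve \<open>v = u powr r\<close>, see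
  lemma \<open>has_integral_ray\<close>.
\<close>

definition ray_value :: "real \<Rightarrow> real \<Rightarrow> ennreal \<Rightarrow> real" where
  "ray_value \<alpha> \<beta> r = (if r = \<infinity> then 0 else 1 / (\<alpha> + \<beta> * enn2real r))"

text \<open>
  The integral of \<open>u powr (\<alpha> - 1) * v powr (\<beta> - 1)\<close> over the sector between the curves with
  exponents \<open>r \<le> s\<close>.
\<close>

definition sector_value :: "real \<Rightarrow> real \<Rightarrow> ennreal \<Rightarrow> ennreal \<Rightarrow> real" where
  "sector_value \<alpha> \<beta> r s = (ray_value \<alpha> \<beta> r - ray_value \<alpha> \<beta> s) / \<beta>"

lemma has_integral_ray:
  assumes "0 < \<alpha>" "0 < \<beta>"
  shows "((\<lambda>u. u powr (\<alpha> - 1) * powr_ennreal u r powr \<beta>) has_integral ray_value \<alpha> \<beta> r) {0..1}"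
proof (cases "r = \<infinity>")
  case False
  define g where "g = \<alpha> + \<beta> * enn2real r"
  have "0 < g" using assms by (simp add: g_def add_pos_nonneg)
  then have "((\<lambda>u. u powr (g - 1)) has_integral (1 powr (g - 1 + 1) / (g - 1 + 1))) {0..1}"
    by (intro has_integral_powr_from_0) auto
  moreover have "u powr (\<alpha> - 1) * powr_ennreal u r powr \<beta> = u powr (g - 1)" for u
    using False by (simp add: powr_ennreal_def powr_powr powr_add[symmetric] g_def algebra_simps)
  ultimately show ?thesis
    using False by (simp add: ray_value_def g_def)
qed (simp add: powr_ennreal_def ray_value_def)

text \<open>
  For fixed \<open>u\<close> the unit interval is cut at the points \<open>u powr r k\<close>. On each piece the
  integral of the power \<open>v powr (\<beta> - 1)\<close> is a difference of values of \<open>v powr \<beta> / \<beta>\<close> on the two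
  boundary curves, and these are then integrated in \<open>u\<close>. The exponents are constrained only
  where the coefficient is nonzero: for the integrand of \<open>\<tau>\<close> they may vanish, but then so
  does the coefficient.
\<close>

lemma nn_integral_sectors:
  fixes F :: "real \<Rightarrow> real \<Rightarrow> real" and r :: "nat \<Rightarrow> ennreal"
  assumes r0: "r 0 = 0" and rn: "r n = \<infinity>" and mono: "\<And>k. k < n \<Longrightarrow> r k \<le> r (Suc k)"
    and [measurable]: "\<And>u. F u \<in> borel_measurable borel"
    and F: "\<And>u v k. 0 < u \<Longrightarrow> u < 1 \<Longrightarrow> k < n \<Longrightarrow> powr_ennreal u (r (Suc k)) < v \<Longrightarrow>
      v < powr_ennreal u (r k) \<Longrightarrow> F u v = c k * u powr (\<alpha> k - 1) * v powr (\<beta> k - 1)"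
    and c: "\<And>k. k < n \<Longrightarrow> 0 \<le> c k" "\<And>k. k < n \<Longrightarrow> c k \<noteq> 0 \<Longrightarrow> 0 < \<alpha> k \<and> 0 < \<beta> k"
  shows "(\<integral>\<^sup>+u. (\<integral>\<^sup>+v. ennreal (F u v) * indicator {0..1} v \<partial>lborel) * indicator {0..1} u \<partial>lborel)
    = ennreal (\<Sum>k<n. c k * sector_value (\<alpha> k) (\<beta> k) (r k) (r (Suc k)))"
proof -
  \<comment> \<open>The integral in \<open>v\<close> over the \<open>k\<close>-th piece, for fixed \<open>u\<close>.\<close>
  define h where "h k u = c k / \<beta> k * (u powr (\<alpha> k - 1) * powr_ennreal u (r k) powr \<beta> k
      - u powr (\<alpha> k - 1) * powr_ennreal u (r (Suc k)) powr \<beta> k)" for k u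
  have h_nonneg: "0 \<le> h k u" if "0 \<le> u" "u \<le> 1" "k < n" for k u
  proof -
    have "powr_ennreal u (r (Suc k)) \<le> powr_ennreal u (r k)" if "0 < u" "u < 1"
      using that mono[OF \<open>k < n\<close>] by (rule powr_ennreal_antimono)
    moreover have "powr_ennreal 1 (r (Suc k)) \<le> powr_ennreal 1 (r k)"
      using mono[OF \<open>k < n\<close>] by (auto simp: powr_ennreal_def top_unique)
    ultimately have "u powr (\<alpha> k - 1) * powr_ennreal u (r (Suc k)) powr \<beta> k
        \<le> u powr (\<alpha> k - 1) * powr_ennreal u (r k) powr \<beta> k" if "0 < \<beta> k"
      using that \<open>0 \<le> u\<close> \<open>u \<le> 1\<close> powr_ennreal_nonneg
      by (cases "u = 0"; cases "u = 1") (auto intro!: mult_left_mono powr_mono2)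
    with c[OF \<open>k < n\<close>] show ?thesis
      unfolding h_def by (cases "c k = 0") auto
  qed
  have inner: "(\<integral>\<^sup>+v. ennreal (F u v) * indicator {0..1} v \<partial>lborel) = ennreal (\<Sum>k<n. h k u)"
    if u: "0 < u" "u < 1" for u
  proof -
    define e where "e k = powr_ennreal u (r k)" for k
    have e_mono: "e (Suc k) \<le> e k" if "k < n" for k
      unfolding e_def using u mono[OF that] by (rule powr_ennreal_antimono)
    have "e 0 = 1" "e n = 0"
      using r0 rn u by (simp_all add: e_def powr_ennreal_def)
    then have "(\<integral>\<^sup>+v. ennreal (F u v) * indicator {0..1} v \<partial>lborel)
        = (\<Sum>k<n. \<integral>\<^sup>+v. ennreal (F u v) * indicator {e (Suc k)..e k} v \<partial>lborel)"
      using nn_integral_telescope[of n e "\<lambda>v. ennreal (F u v)"] e_mono by simp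
    also have "\<dots> = (\<Sum>k<n. ennreal (h k u))"
    proof (intro sum.cong refl)
      fix k assume "k \<in> {..<n}"
      then have k: "k < n" by simp
      have "(\<integral>\<^sup>+v. ennreal (F u v) * indicator {e (Suc k)..e k} v \<partial>lborel)
          = (\<integral>\<^sup>+v. ennreal (c k * u powr (\<alpha> k - 1)) *
              (ennreal (v powr (\<beta> k - 1)) * indicator {e (Suc k)..e k} v) \<partial>lborel)"
        using AE_lborel_singleton[of "e k"] AE_lborel_singleton[of "e (Suc k)"]
      proof (intro nn_integral_cong_AE, eventually_elim)
        case (elim v)
        have "F u v = c k * u powr (\<alpha> k - 1) * v powr (\<beta> k - 1)" if "e (Suc k) < v" "v < e k"
          using F[OF u k] that unfolding e_def .
        with elim c(1)[OF k] show ?case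
          by (cases "v \<in> {e (Suc k)..e k}") (simp_all add: ennreal_mult)
      qed
      also have "\<dots> = ennreal (c k * u powr (\<alpha> k - 1)) *
          (\<integral>\<^sup>+v. ennreal (v powr (\<beta> k - 1)) * indicator {e (Suc k)..e k} v \<partial>lborel)"
        by (intro nn_integral_cmult) measurable
      also have "\<dots> = ennreal (h k u)"
      proof (cases "c k = 0")
        case False
        with c[OF k] have "0 < \<beta> k" by simp
        then show ?thesis
          using e_mono[OF k] powr_ennreal_nonneg c(1)[OF k]
          by (subst nn_integral_powr) (auto simp: e_def h_def ennreal_mult'[symmetric] algebra_simps
            diff_divide_distrib)
      qed (simp add: h_def)
      finally show "(\<integral>\<^sup>+v. ennreal (F u v) * indicator {e (Suc k)..e k} v \<partial>lborel) = ennreal (h k u)" .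
    qed
    also have "\<dots> = ennreal (\<Sum>k<n. h k u)"
      using u h_nonneg by (intro sum_ennreal) auto
    finally show ?thesis .
  qed
  have "(\<integral>\<^sup>+u. (\<integral>\<^sup>+v. ennreal (F u v) * indicator {0..1} v \<partial>lborel) * indicator {0..1} u \<partial>lborel)
      = (\<integral>\<^sup>+u. ennreal (\<Sum>k<n. h k u) * indicator {0..1} u \<partial>lborel)"
    using AE_lborel_singleton[of "0::real"] AE_lborel_singleton[of "1::real"]
  proof (intro nn_integral_cong_AE, eventually_elim)
    case (elim u)
    then show ?case
      by (cases "u \<in> {0..1}") (simp_all add: inner)
  qed
  also have "\<dots> = ennreal (\<Sum>k<n. c k * sector_value (\<alpha> k) (\<beta> k) (r k) (r (Suc k)))"
  proof (rule nn_integral_has_integral_lebesgue')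
    have "(h k has_integral c k * sector_value (\<alpha> k) (\<beta> k) (r k) (r (Suc k))) {0..1}" if k: "k < n" for k
    proof (cases "c k = 0")
      case False
      with c[OF k] have "0 < \<alpha> k" "0 < \<beta> k" by simp_all
      then have "(h k has_integral c k / \<beta> k * (ray_value (\<alpha> k) (\<beta> k) (r k) - ray_value (\<alpha> k) (\<beta> k) (r (Suc k)))) {0..1}"
        unfolding h_def by (intro has_integral_mult_right has_integral_diff has_integral_ray)
      then show ?thesis by (simp add: sector_value_def)
    qed (simp add: h_def[abs_def])
    then show "((\<lambda>u. \<Sum>k<n. h k u) has_integral (\<Sum>k<n. c k * sector_value (\<alpha> k) (\<beta> k) (r k) (r (Suc k)))) {0..1}"
      by (intro has_integral_sum) auto
    show "0 \<le> (\<Sum>k<n. h k u)" if "u \<in> {0..1}" for u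
      using that h_nonneg by (intro sum_nonneg) auto
  qed
  finally show ?thesis .
qed

text \<open>
  The summands of \<open>\<tau>\<close> and \<open>\<rho>\<close> are sector values by partial fractions, which also make the limit
  \<open>y \<rightarrow> \<infinity>\<close> evident: it is the value with \<open>1 / (\<alpha> + \<beta> * y)\<close> replaced by \<open>0\<close>.
\<close>

lemma ratio_summand_eq_sector_value:
  assumes rs: "r \<le> s" and c: "c \<noteq> 0 \<Longrightarrow> 0 < \<alpha> \<and> 0 < \<beta>"
  shows "ratio_summand (\<lambda>x y. c * (y - x) / ((\<beta> * x + \<alpha>) * (\<beta> * y + \<alpha>))) r s
    = c * sector_value \<alpha> \<beta> r s"
proof (cases "r = s \<or> c = 0")
  case True
  have "Lim at_top (\<lambda>y::real. 0::real) = 0"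
    by (intro tendsto_Lim) simp_all
  with True show ?thesis
    by (auto simp: ratio_summand_def sector_value_def at_ratio_def)
next
  case False
  then have pos: "0 < \<alpha>" "0 < \<beta>" and "r \<noteq> s" using c by auto
  define x where "x = enn2real r"
  have x: "0 \<le> x" by (simp add: x_def)
  have "0 < \<alpha> + \<beta> * x" using pos x by (simp add: add_pos_nonneg)
  have r: "r \<noteq> \<infinity>" using rs \<open>r \<noteq> s\<close> by (auto simp: top_unique)
  have frac: "c * (y - x) / ((\<beta> * x + \<alpha>) * (\<beta> * y + \<alpha>)) = c / \<beta> * (1 / (\<alpha> + \<beta> * x) - 1 / (\<alpha> + \<beta> * y))"
    if "0 \<le> y" for y
  proof -
    have "0 < \<alpha> + \<beta> * y" using pos that by (simp add: add_pos_nonneg)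
    with \<open>0 < \<alpha> + \<beta> * x\<close> pos show ?thesis by (simp add: divide_simps) (simp add: algebra_simps)
  qed
  show ?thesis
  proof (cases "s = \<infinity>")
    case True
    have "((\<lambda>y. c / \<beta> * (1 / (\<alpha> + \<beta> * x) - 1 / (\<alpha> + \<beta> * y))) \<longlongrightarrow> c / \<beta> * (1 / (\<alpha> + \<beta> * x) - 0)) at_top"
      using pos by (intro tendsto_intros) real_asymp
    then have "((\<lambda>y. c * (y - x) / ((\<beta> * x + \<alpha>) * (\<beta> * y + \<alpha>))) \<longlongrightarrow> c / \<beta> * (1 / (\<alpha> + \<beta> * x) - 0)) at_top"
      by (rule Lim_transform_eventually)
        (use eventually_ge_at_top[of 0] in \<open>eventually_elim, simp only: frac\<close>)
    then have "Lim at_top (\<lambda>y. c * (y - x) / ((\<beta> * x + \<alpha>) * (\<beta> * y + \<alpha>))) = c / \<beta> * (1 / (\<alpha> + \<beta> * x) - 0)"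
      by (intro tendsto_Lim) simp_all
    with True r \<open>r \<noteq> s\<close> show ?thesis
      by (simp add: ratio_summand_def at_ratio_def sector_value_def ray_value_def x_def)
  next
    case False
    with r \<open>r \<noteq> s\<close> show ?thesis
      by (simp add: ratio_summand_def at_ratio_def sector_value_def ray_value_def frac[unfolded x_def])
  qed
qed

text \<open>
  In a sector \<open>u * v * \<partial>\<^sub>1 C * \<partial>\<^sub>2 C\<close> is a multiple of \<open>C\<^sup>2\<close>, so the integral for \<open>\<tau>\<close> has
  twice the exponents of \<open>C\<close>, while the formula for \<open>\<tau>\<close> is written with the exponents of \<open>C\<close>.
\<close>

lemma sector_value_double: "sector_value (2 * \<alpha>) (2 * \<beta>) r s = sector_value \<alpha> \<beta> r s / 4"
proof -
  have "ray_value (2 * \<alpha>) (2 * \<beta>) t = ray_value \<alpha> \<beta> t / 2" for t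
  proof -
    have "2 * \<alpha> + 2 * \<beta> * enn2real t = 2 * (\<alpha> + \<beta> * enn2real t)"
      by (simp add: algebra_simps)
    then have "1 / (2 * \<alpha> + 2 * \<beta> * enn2real t) = 1 / (\<alpha> + \<beta> * enn2real t) / 2"
      by (simp only: divide_divide_eq_left mult.commute)
    then show ?thesis
      by (cases "t = \<infinity>") (simp_all only: ray_value_def if_True if_False div_0 simp_thms)
  qed
  then have "sector_value (2 * \<alpha>) (2 * \<beta>) r s = (ray_value \<alpha> \<beta> r / 2 - ray_value \<alpha> \<beta> s / 2) / (2 * \<beta>)"
    by (simp only: sector_value_def)
  then show ?thesis
    by (simp add: sector_value_def field_simps)
qed

lemma sector_value_nonneg:
  assumes "0 < \<alpha>" "0 < \<beta>" "r \<le> s"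
  shows "0 \<le> sector_value \<alpha> \<beta> r s"
proof -
  have "ray_value \<alpha> \<beta> s \<le> ray_value \<alpha> \<beta> r"
  proof (cases "s = \<infinity>")
    case True
    then show ?thesis using assms by (simp add: ray_value_def)
  next
    case False
    with assms have "r \<noteq> \<infinity>" "enn2real r \<le> enn2real s"
      by (auto simp: less_top top_unique intro!: enn2real_mono)
    with False assms show ?thesis
      by (auto simp: ray_value_def intro!: frac_le add_pos_nonneg mult_left_mono)
  qed
  with assms show ?thesis by (simp add: sector_value_def)
qed

text \<open>
  The first term of the formula for \<open>\<rho>\<close> is the contribution of the two outer sectors. The
  exponents there are \<open>\<alpha> = 2, \<beta> = 1\<close> above all curves, where \<open>C u v = u\<close>, and \<open>\<alpha> = 1, \<beta> = 2\<close>
  below all curves, where \<open>C u v = v\<close>.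
\<close>

lemma at_ratio_outer_sectors:
  assumes "r \<noteq> \<infinity>"
  shows "at_ratio (\<lambda>y. let x = enn2real r in 12 * (1 + x + x * y) / ((2 + x) * (1 + 2 * y))) s
    = 12 * (sector_value 2 1 0 r + sector_value 1 2 s \<infinity>)"
proof -
  define x where "x = enn2real r"
  have x: "0 \<le> x" by (simp add: x_def)
  have frac: "12 * (1 + x + x * y) / ((2 + x) * (1 + 2 * y)) = 12 * ((1 / 2 - 1 / (2 + x)) + 1 / (1 + 2 * y) / 2)"
    if "0 \<le> y" for y
  proof -
    have "0 < 2 + x" "0 < 1 + 2 * y" using that x by simp_all
    then show ?thesis by (simp add: divide_simps) (simp add: algebra_simps)
  qed
  show ?thesis
  proof (cases "s = \<infinity>")
    case True
    have "((\<lambda>y. 12 * ((1 / 2 - 1 / (2 + x)) + 1 / (1 + 2 * y) / 2)) \<longlongrightarrow> 12 * ((1 / 2 - 1 / (2 + x)) + 0)) at_top"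
      by (intro tendsto_intros) real_asymp
    then have "((\<lambda>y. 12 * (1 + x + x * y) / ((2 + x) * (1 + 2 * y))) \<longlongrightarrow> 12 * ((1 / 2 - 1 / (2 + x)) + 0)) at_top"
      by (rule Lim_transform_eventually)
        (use eventually_ge_at_top[of 0] in \<open>eventually_elim, simp only: frac\<close>)
    then have "Lim at_top (\<lambda>y. 12 * (1 + x + x * y) / ((2 + x) * (1 + 2 * y))) = 12 * ((1 / 2 - 1 / (2 + x)) + 0)"
      by (intro tendsto_Lim) simp_all
    with True assms show ?thesis
      by (simp add: at_ratio_def Let_def sector_value_def ray_value_def x_def[symmetric])
  next
    case False
    then show ?thesis
      using assms frac[of "enn2real s"]
      by (simp add: at_ratio_def Let_def sector_value_def ray_value_def x_def[symmetric])
  qed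
qed

section \<open>The measures of association\<close>

locale sorted_liebscher_weights = liebscher_weights +
  assumes ratio_well_defined: "k \<in> {1..K} \<Longrightarrow> (p k, q k) \<noteq> (0, 0)"
    and ratio_le_Suc: "k \<in> {1..<K} \<Longrightarrow> ratio p q k \<le> ratio p q (Suc k)"
begin

sublocale swapped: liebscher_weights K q p
  by (rule swap)

definition D2 :: "real \<Rightarrow> real \<Rightarrow> real" where "D2 u v = swapped.D1 v u"

definition P :: "nat \<Rightarrow> real" where "P k = (\<Sum>i=1..k. p i)"

definition Q :: "nat \<Rightarrow> real" where "Q k = (\<Sum>i=1..k. q i)"

text \<open>
  The two added values turn the outer regions, next to \<open>v = 1\<close> and next to \<open>v = 0\<close>, into
  sectors like the others.
\<close>

definition r :: "nat \<Rightarrow> ennreal" where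
  "r k = (if k = 0 then 0 else if k \<le> K then ratio p q k else \<infinity>)"

lemma r_le_Suc: "r k \<le> r (Suc k)"
  using ratio_le_Suc[of k] by (auto simp: r_def)

lemma r_mono: "i \<le> j \<Longrightarrow> r i \<le> r j"
  using r_le_Suc by (rule lift_Suc_mono_le)

lemma sum_split: "k \<le> K \<Longrightarrow> sum f {1..K} = sum f {1..k} + sum f {k + 1..K}" for f :: "nat \<Rightarrow> real"
  by (metis add.commute le_add1 sum.ub_add_nat le_add_diff_inverse)

lemma sum_p_tail: "k \<le> K \<Longrightarrow> (\<Sum>i=k+1..K. p i) = 1 - P k"
  using sum_split[of k p] sum_p by (simp add: P_def)

lemma one_minus_P_nonneg: "k \<le> K \<Longrightarrow> 0 \<le> 1 - P k"
  by (subst sum_p_tail[symmetric]) (auto intro!: sum_nonneg p_nonneg)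

lemma Q_nonneg: "k \<le> K \<Longrightarrow> 0 \<le> Q k"
  unfolding Q_def by (auto intro!: sum_nonneg q_nonneg)

text \<open>
  A point of the \<open>k\<close>-th sector lies below the curves with index \<open>i \<le> k\<close>, where the minimum is
  \<open>v powr q i\<close>, and above the others, where it is \<open>u powr p i\<close>.
\<close>

lemma sector:
  assumes u: "0 < u" "u < 1" and k: "k < Suc K"
    and v: "powr_ennreal u (r (Suc k)) < v" "v < powr_ennreal u (r k)"
  shows C_sector: "C u v = u powr (1 - P k) * v powr Q k"
    and D1_sector: "D1 u v = C u v / u * (1 - P k)"
    and D2_sector: "D2 u v = C u v / v * Q k"
proof -
  have v0: "0 < v"
    using v(1) by (rule le_less_trans[OF powr_ennreal_nonneg])
  have lower: "q i * ln v < p i * ln u" if i: "i \<in> {1..k}" for i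
  proof (rule ln_less_if_powr_ennreal_ratio(1))
    have "powr_ennreal u (r k) \<le> powr_ennreal u (r i)"
      using u i by (intro powr_ennreal_antimono r_mono) auto
    then show "v < powr_ennreal u (ennreal (p i) / ennreal (q i))"
      using v i k by (simp add: r_def ratio_def)
  qed (use i k u v0 p_nonneg q_nonneg ratio_well_defined in auto)
  have upper: "p i * ln u < q i * ln v" if i: "i \<in> {k+1..K}" for i
  proof (rule ln_less_if_powr_ennreal_ratio(2))
    have "powr_ennreal u (r i) \<le> powr_ennreal u (r (Suc k))"
      using u i by (intro powr_ennreal_antimono r_mono) auto
    then show "powr_ennreal u (ennreal (p i) / ennreal (q i)) < v"
      using v i k by (simp add: r_def ratio_def)
  qed (use i k u v0 p_nonneg q_nonneg ratio_well_defined in auto)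
  have kK: "k \<le> K" using k by simp
  have "(\<Sum>i=1..K. min (p i * ln u) (q i * ln v)) = (\<Sum>i=1..k. q i * ln v) + (\<Sum>i=k+1..K. p i * ln u)"
    unfolding sum_split[OF kK]
    by (intro arg_cong2[of _ _ _ _ "(+)"] sum.cong refl) (use lower upper in \<open>force simp: min_def\<close>)+
  also have "\<dots> = Q k * ln v + (1 - P k) * ln u"
    by (simp only: Q_def sum_distrib_right[symmetric] sum_p_tail[OF kK])
  finally show "C u v = u powr (1 - P k) * v powr Q k"
    using u v0 by (simp add: C_eq_exp powr_def exp_add)
  have "(\<Sum>i=1..K. if p i * ln u < q i * ln v then p i else 0) = (\<Sum>i=1..k. 0) + (\<Sum>i=k+1..K. p i)"
    unfolding sum_split[OF kK]
    by (intro arg_cong2[of _ _ _ _ "(+)"] sum.cong refl) (use lower upper in force)+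
  then show "D1 u v = C u v / u * (1 - P k)"
    by (simp only: D1_def sum_p_tail[OF kK] sum.neutral_const add_0_left)
  have "(\<Sum>i=1..K. if q i * ln v < p i * ln u then q i else 0) = (\<Sum>i=1..k. q i) + (\<Sum>i=k+1..K. 0)"
    unfolding sum_split[OF kK]
    by (intro arg_cong2[of _ _ _ _ "(+)"] sum.cong refl) (use lower upper in force)+
  then show "D2 u v = C u v / v * Q k"
    by (simp only: D2_def swapped.D1_def C_swap Q_def sum.neutral_const add_0_right)
qed

lemma set_integral_C:
  assumes "sets M = sets borel"
  shows "(LINT z:{0..1} \<times> {0..1}|M. C (fst z) (snd z))
    = enn2real (\<integral>\<^sup>+z. ennreal (C (fst z) (snd z)) * indicator ({0..1} \<times> {0..1}) z \<partial>M)"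
proof -
  have "(LINT z:{0..1} \<times> {0..1}|M. C (fst z) (snd z))
      = enn2real (\<integral>\<^sup>+z. ennreal (indicator ({0..1} \<times> {0..1}) z *\<^sub>R C (fst z) (snd z)) \<partial>M)"
    unfolding set_lebesgue_integral_def
  proof (rule integral_eq_nn_integral)
    show "(\<lambda>z. indicator ({0..1} \<times> {0..1}) z *\<^sub>R C (fst z) (snd z)) \<in> borel_measurable M"
      unfolding measurable_cong_sets[OF assms refl]
      by (intro borel_measurable_scaleR borel_measurable_indicator borel_closed closed_Times C_measurable
        borel_measurable_continuous_onI continuous_intros closed_atLeastAtMost)
  qed (simp add: C_nonneg)
  also have "(\<integral>\<^sup>+z. ennreal (indicator ({0..1} \<times> {0..1}) z *\<^sub>R C (fst z) (snd z)) \<partial>M)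
      = (\<integral>\<^sup>+z. ennreal (C (fst z) (snd z)) * indicator ({0..1} \<times> {0..1}) z \<partial>M)"
    by (intro nn_integral_cong) (auto simp: indicator_def)
  finally show ?thesis .
qed

lemma kendall_tau_C:
  "kendall_tau C = 1 - (\<Sum>k<Suc K. (1 - P k) * Q k * sector_value (1 - P k) (Q k) (r k) (r (Suc k)))"
proof -
  define S where "S = (\<Sum>k<Suc K. (1 - P k) * Q k * sector_value (1 - P k) (Q k) (r k) (r (Suc k)))"
  define X where
    "X = (\<integral>\<^sup>+z. ennreal (C (fst z) (snd z)) * indicator ({0..1} \<times> {0..1}) z \<partial>copula_measure C)"
  have ibp: "X + (\<integral>\<^sup>+u. (\<integral>\<^sup>+v. ennreal (D1 u v) * ennreal (D2 u v) * indicator {0..1} v \<partial>lborel)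
      * indicator {0..1} u \<partial>lborel) = ennreal (1 / 2)"
    unfolding X_def
  proof (rule integration_by_parts_copula[OF copula_measure])
    show "(\<lambda>z. C (fst z) (snd z)) \<in> borel_measurable borel"
      "(\<lambda>z. D1 (fst z) (snd z)) \<in> borel_measurable borel"
      "(\<lambda>z. D2 (fst z) (snd z)) \<in> borel_measurable borel"
      unfolding D2_def by (intro C_measurable D1_measurable swapped.D1_measurable
        borel_measurable_continuous_onI continuous_intros)+
    show "(\<integral>\<^sup>+x. ennreal (D1 x v) * indicator {u..1} x \<partial>lborel) = ennreal (C 1 v - C u v)"
      if "u \<in> {0..1}" "v \<in> {0..1}" for u v
      using that by (intro nn_integral_D1) auto
    show "(\<integral>\<^sup>+y. ennreal (D2 u y) * indicator {0..v} y \<partial>lborel) = ennreal (C u v)"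
      if "u \<in> {0..1}" "v \<in> {0..1}" for u v
      using that swapped.nn_integral_D1[of 0 v u] unfolding D2_def C_swap by (simp add: C_0_right)
  qed (simp_all add: C_1_left)
  have "(\<integral>\<^sup>+u. (\<integral>\<^sup>+v. ennreal (D1 u v) * ennreal (D2 u v) * indicator {0..1} v \<partial>lborel)
      * indicator {0..1} u \<partial>lborel)
    = (\<integral>\<^sup>+u. (\<integral>\<^sup>+v. ennreal (D1 u v * D2 u v) * indicator {0..1} v \<partial>lborel) * indicator {0..1} u \<partial>lborel)"
    by (intro nn_integral_cong) (auto simp: indicator_def D2_def ennreal_mult D1_nonneg swapped.D1_nonneg
      intro!: nn_integral_cong)
  also have "\<dots> = ennreal (\<Sum>k<Suc K. (1 - P k) * Q k *
      sector_value (2 * (1 - P k)) (2 * Q k) (r k) (r (Suc k)))"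
  proof (rule nn_integral_sectors)
    show "D1 u v * D2 u v = (1 - P k) * Q k * u powr (2 * (1 - P k) - 1) * v powr (2 * Q k - 1)"
      if "0 < u" "u < 1" "k < Suc K" "powr_ennreal u (r (Suc k)) < v" "v < powr_ennreal u (r k)" for u v k
    proof -
      have "0 < v"
        using that(4) by (rule le_less_trans[OF powr_ennreal_nonneg])
      have sq: "w powr (2 * a - 1) = w powr a * w powr a / w" if "0 < w" for w a :: real
        using that by (simp add: powr_diff powr_add[symmetric])
      show ?thesis
        unfolding D1_sector[OF that] D2_sector[OF that] C_sector[OF that] sq[OF \<open>0 < u\<close>] sq[OF \<open>0 < v\<close>]
        by simp
    qed
    show "(\<lambda>v. D1 u v * D2 u v) \<in> borel_measurable borel" for u
      unfolding D2_def by (intro borel_measurable_times D1_measurable swapped.D1_measurable) auto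
    show "0 < 2 * (1 - P k) \<and> 0 < 2 * Q k" if "k < Suc K" "(1 - P k) * Q k \<noteq> 0" for k
      using that one_minus_P_nonneg[of k] Q_nonneg[of k] by auto
    show "0 \<le> (1 - P k) * Q k" if "k < Suc K" for k
      using that one_minus_P_nonneg[of k] Q_nonneg[of k] by auto
  qed (auto simp: r_le_Suc, auto simp: r_def)
  also have "(\<Sum>k<Suc K. (1 - P k) * Q k * sector_value (2 * (1 - P k)) (2 * Q k) (r k) (r (Suc k))) = S / 4"
    unfolding S_def sum_divide_distrib sector_value_double times_divide_eq_right ..
  finally have X: "X + ennreal (S / 4) = ennreal (1 / 2)"
    using ibp by simp
  have "0 \<le> (1 - P k) * Q k * sector_value (1 - P k) (Q k) (r k) (r (Suc k))" if "k < Suc K" for k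
    using sector_value_nonneg[OF _ _ r_le_Suc, of "1 - P k" "Q k" k] one_minus_P_nonneg[of k] Q_nonneg[of k] that
    by (cases "(1 - P k) * Q k = 0") auto
  then have S: "0 \<le> S"
    unfolding S_def by (intro sum_nonneg) simp
  have "ennreal (S / 4) \<le> ennreal (1 / 2)"
    unfolding X[symmetric] by simp
  then have S_le: "S / 4 \<le> 1 / 2"
    by (subst (asm) ennreal_le_iff) simp_all
  have "X = ennreal (1 / 2) - ennreal (S / 4)"
    unfolding X[symmetric] by simp
  also have "\<dots> = ennreal (1 / 2 - S / 4)"
    using S by (intro ennreal_minus) simp
  finally have "enn2real X = 1 / 2 - S / 4"
    using S_le by simp
  then show ?thesis
    unfolding kendall_tau_def set_integral_C[OF copula_measure(2)] X_def[symmetric] S_def[symmetric]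
    by simp
qed

lemma spearman_rho_C:
  "spearman_rho C = 12 * (\<Sum>k<Suc K. sector_value (2 - P k) (1 + Q k) (r k) (r (Suc k))) - 3"
proof -
  define S where "S = (\<Sum>k<Suc K. 1 * sector_value (2 - P k) (1 + Q k) (r k) (r (Suc k)))"
  have "(\<lambda>z. C (fst z) (snd z)) \<in> borel_measurable (borel :: (real \<times> real) measure)"
    by (intro C_measurable borel_measurable_continuous_onI continuous_intros)
  then have "(\<lambda>z. ennreal (C (fst z) (snd z))) \<in> borel_measurable (borel :: (real \<times> real) measure)"
    by (rule measurable_compose[OF _ measurable_ennreal])
  then have "(\<lambda>z. ennreal (C (fst z) (snd z)) * indicator ({0..1} \<times> {0..1}) z)
      \<in> borel_measurable (borel :: (real \<times> real) measure)"
    by (intro borel_measurable_times_ennreal borel_measurable_indicator borel_closed closed_Times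
      closed_atLeastAtMost)
  then have meas: "(\<lambda>z. ennreal (C (fst z) (snd z)) * indicator ({0..1} \<times> {0..1}) z)
      \<in> borel_measurable (lborel \<Otimes>\<^sub>M (lborel :: real measure))"
    by (simp only: lborel_prod measurable_cong_sets[OF sets_lborel refl])
  have "(\<integral>\<^sup>+z. ennreal (C (fst z) (snd z)) * indicator ({0..1} \<times> {0..1}) z \<partial>lborel)
      = (\<integral>\<^sup>+u. (\<integral>\<^sup>+v. ennreal (C u v) * indicator ({0..1} \<times> {0..1}) (u, v) \<partial>lborel) \<partial>lborel)"
    using lborel.nn_integral_fst[OF meas] unfolding lborel_prod fst_conv snd_conv ..
  also have "\<dots> = (\<integral>\<^sup>+u. (\<integral>\<^sup>+v. ennreal (C u v) * indicator {0..1} v \<partial>lborel) * indicator {0..1} u \<partial>lborel)"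
  proof (rule nn_integral_cong)
    show "(\<integral>\<^sup>+v. ennreal (C u v) * indicator ({0..1} \<times> {0..1}) (u, v) \<partial>lborel)
        = (\<integral>\<^sup>+v. ennreal (C u v) * indicator {0..1} v \<partial>lborel) * indicator {0..1} u" for u
      by (cases "u \<in> {0..1}") (simp_all add: indicator_times)
  qed
  also have "\<dots> = ennreal S"
    unfolding S_def
  proof (rule nn_integral_sectors)
    show "C u v = 1 * u powr (2 - P k - 1) * v powr (1 + Q k - 1)"
      if "0 < u" "u < 1" "k < Suc K" "powr_ennreal u (r (Suc k)) < v" "v < powr_ennreal u (r k)" for u v k
      using C_sector[OF that] by (simp add: algebra_simps)
    show "(\<lambda>v. C u v) \<in> borel_measurable borel" for u
      by (intro C_measurable) auto
    show "0 < 2 - P k \<and> 0 < 1 + Q k" if "k < Suc K" for k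
      using that one_minus_P_nonneg[of k] Q_nonneg[of k] by auto
  qed (auto simp: r_le_Suc, auto simp: r_def)
  finally have C_integral:
    "(\<integral>\<^sup>+z. ennreal (C (fst z) (snd z)) * indicator ({0..1} \<times> {0..1}) z \<partial>lborel) = ennreal S" .
  have "0 \<le> S"
    unfolding S_def
  proof (intro sum_nonneg)
    show "0 \<le> 1 * sector_value (2 - P k) (1 + Q k) (r k) (r (Suc k))" if "k \<in> {..<Suc K}" for k
      using sector_value_nonneg[OF _ _ r_le_Suc, of "2 - P k" "1 + Q k" k] one_minus_P_nonneg[of k] Q_nonneg[of k] that
      by auto
  qed
  then show ?thesis
    unfolding spearman_rho_def set_integral_C[OF sets_lborel] C_integral by (simp only: S_def enn2real_ennreal mult_1)
qed

text \<open>
  At \<open>u = v = 1/2\<close> the logarithm of \<open>C\<close> is \<open>- ln 2\<close> times the sum of the \<open>max (p k) (q k)\<close>, and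
  \<open>max a b = a + b - min a b\<close>.
\<close>

lemma blomqvist_beta_C: "blomqvist_beta C = 2 powr (\<Sum>k=1..K. min (p k) (q k)) - 1"
proof -
  have "(\<Sum>k=1..K. min (p k * ln (1/2)) (q k * ln (1/2))) = (\<Sum>k=1..K. (min (p k) (q k) - p k - q k) * ln 2)"
    by (intro sum.cong) (auto simp: min_def ln_div algebra_simps)
  also have "\<dots> = ((\<Sum>k=1..K. min (p k) (q k)) - 2) * ln 2"
    by (simp only: sum_distrib_right[symmetric] sum_subtractf sum_p sum_q) simp
  finally have "C (1/2) (1/2) = 2 powr ((\<Sum>k=1..K. min (p k) (q k)) - 2)"
    by (simp only: C_eq_exp powr_def) simp
  then show ?thesis
    by (simp add: blomqvist_beta_def powr_diff)
qed

end

theorem proposition7: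
  fixes K :: nat and p q :: "nat \<Rightarrow> real"
  assumes "K \<ge> 2"
    and "\<forall>k\<in>{1..K}. p k \<in> {0..1} \<and> q k \<in> {0..1}"
    and "(\<Sum>k=1..K. p k) = 1" and "(\<Sum>k=1..K. q k) = 1"
    and "\<forall>k\<in>{1..K}. (p k, q k) \<noteq> (0, 0)"
    and "\<forall>k\<in>{1..K-1}. ratio p q k \<le> ratio p q (k + 1)"
  defines "C \<equiv> comonotonic_liebscher K p q"
    and "r \<equiv> ratio p q"
    and "P \<equiv> \<lambda>k. \<Sum>i=1..k. p i"
    and "Q \<equiv> \<lambda>k. \<Sum>i=1..k. q i"
  shows "blomqvist_beta C = 2 powr (\<Sum>k=1..K. min (p k) (q k)) - 1
    \<and> kendall_tau C = 1 - (\<Sum>k=1..K-1.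
        ratio_summand (\<lambda>x y. (1 - P k) * Q k * (y - x)
            / ((Q k * x + (1 - P k)) * (Q k * y + (1 - P k)))) (r k) (r (k + 1)))
    \<and> spearman_rho C =
        at_ratio (\<lambda>y. let x = enn2real (r 1) in
            12 * (1 + x + x * y) / ((2 + x) * (1 + 2 * y))) (r K)
        - 3
        + 12 * (\<Sum>k=1..K-1.
            ratio_summand (\<lambda>x y. (y - x)
              / (((1 + Q k) * x + (2 - P k)) * ((1 + Q k) * y + (2 - P k)))) (r k) (r (k + 1)))"
proof -
  interpret L: sorted_liebscher_weights K p q
    using assms(1-6) by unfold_locales auto
  have PQ: "P k = L.P k" "Q k = L.Q k" for k
    by (simp_all add: P_def Q_def L.P_def L.Q_def)
  have r: "r k = L.r k" "r (k + 1) = L.r (Suc k)" if "k \<in> {1..K-1}" for k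
    using that by (auto simp: r_def L.r_def)
  have split: "(\<Sum>k<Suc K. f k) = f 0 + (\<Sum>k=1..K-1. f k) + f K" for f :: "nat \<Rightarrow> real"
  proof -
    have "{..<Suc K} = insert 0 (insert K {1..K-1})" using assms(1) by auto
    then show ?thesis using assms(1) by simp
  qed
  have ends: "L.P 0 = 0" "L.Q 0 = 0" "L.P K = 1" "L.Q K = 1" "L.r 0 = 0" "L.r (Suc K) = \<infinity>"
    "L.r 1 = r 1" "L.r K = r K"
    using assms(1) L.sum_p L.sum_q by (simp_all add: L.P_def L.Q_def L.r_def r_def)
  \<comment> \<open>The outer sectors drop out, as \<open>Q 0 = 0\<close> and \<open>1 - P K = 0\<close>.\<close>
  have "kendall_tau C = 1 - (\<Sum>k=1..K-1.
      (1 - P k) * Q k * sector_value (1 - P k) (Q k) (L.r k) (L.r (Suc k)))"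
    unfolding C_def L.kendall_tau_C split by (simp add: ends PQ)
  also have "(\<Sum>k=1..K-1. (1 - P k) * Q k * sector_value (1 - P k) (Q k) (L.r k) (L.r (Suc k)))
      = (\<Sum>k=1..K-1. ratio_summand (\<lambda>x y. (1 - P k) * Q k * (y - x)
          / ((Q k * x + (1 - P k)) * (Q k * y + (1 - P k)))) (r k) (r (k + 1)))"
  proof (intro sum.cong refl)
    fix k assume k: "k \<in> {1..K-1}"
    then have "0 \<le> 1 - P k" "0 \<le> Q k"
      using L.one_minus_P_nonneg[of k] L.Q_nonneg[of k] unfolding PQ by force+
    then show "(1 - P k) * Q k * sector_value (1 - P k) (Q k) (L.r k) (L.r (Suc k))
        = ratio_summand (\<lambda>x y. (1 - P k) * Q k * (y - x)
          / ((Q k * x + (1 - P k)) * (Q k * y + (1 - P k)))) (r k) (r (k + 1))"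
      unfolding r[OF k] by (intro ratio_summand_eq_sector_value[symmetric] L.r_le_Suc) auto
  qed
  finally have tau: "kendall_tau C = 1 - (\<Sum>k=1..K-1. ratio_summand (\<lambda>x y. (1 - P k) * Q k * (y - x)
          / ((Q k * x + (1 - P k)) * (Q k * y + (1 - P k)))) (r k) (r (k + 1)))" .
  \<comment> \<open>If the smallest ratio were infinite, all ratios would be, so all \<open>q k\<close> would vanish.\<close>
  have "r 1 \<noteq> \<infinity>"
  proof
    assume r1: "r 1 = \<infinity>"
    have "q k = 0" if k: "k \<in> {1..K}" for k
    proof -
      have "L.r 1 \<le> L.r k" using k by (intro L.r_mono) simp
      with r1 ends k have "ennreal (p k) / ennreal (q k) = \<infinity>"
        by (simp add: L.r_def ratio_def top_unique)
      with L.q_nonneg[OF k] show ?thesis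
        by (simp add: ennreal_divide_eq_top_iff)
    qed
    then have "(\<Sum>k=1..K. q k) = 0" by simp
    with assms(4) show False by simp
  qed
  then have outer: "at_ratio (\<lambda>y. let x = enn2real (r 1) in 12 * (1 + x + x * y) / ((2 + x) * (1 + 2 * y))) (r K)
      = 12 * (sector_value 2 1 0 (r 1) + sector_value 1 2 (r K) \<infinity>)"
    by (rule at_ratio_outer_sectors)
  have inner: "ratio_summand (\<lambda>x y. (y - x) / (((1 + Q k) * x + (2 - P k)) * ((1 + Q k) * y + (2 - P k))))
        (r k) (r (k + 1)) = sector_value (2 - P k) (1 + Q k) (L.r k) (L.r (Suc k))" if k: "k \<in> {1..K-1}" for k
  proof -
    have "0 \<le> 1 - P k" "0 \<le> Q k"
      using k L.one_minus_P_nonneg[of k] L.Q_nonneg[of k] unfolding PQ by force+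
    then show ?thesis
      unfolding r[OF k]
      using ratio_summand_eq_sector_value[OF L.r_le_Suc, of 1 "2 - P k" "1 + Q k" k] by simp
  qed
  have "spearman_rho C = 12 * (sector_value 2 1 0 (r 1) + (\<Sum>k=1..K-1.
      sector_value (2 - P k) (1 + Q k) (L.r k) (L.r (Suc k))) + sector_value 1 2 (r K) \<infinity>) - 3"
    unfolding C_def L.spearman_rho_C split by (simp add: ends[unfolded One_nat_def] PQ)
  also have "(\<Sum>k=1..K-1. sector_value (2 - P k) (1 + Q k) (L.r k) (L.r (Suc k)))
      = (\<Sum>k=1..K-1. ratio_summand (\<lambda>x y. (y - x)
          / (((1 + Q k) * x + (2 - P k)) * ((1 + Q k) * y + (2 - P k)))) (r k) (r (k + 1)))"
    by (intro sum.cong refl inner[symmetric])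
  finally show ?thesis
    using L.blomqvist_beta_C tau unfolding outer by (simp add: C_def algebra_simps)
qed

end
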